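(* Let $m>1$ and $n\ge 1$ be integers. For $i\in\{1,\dots,m\}$ let $A_i\in\mathbb{R}^{n_i\times n}$ and $b_i\in\mathbb{R}^{n_i}$, let $A$ be the matrix obtained by stacking $A_1,\dots,A_m$ and $b$ the vector obtained by stacking $b_1,\dots,b_m$, and suppose that $Ax=b$ has at least one solution. Let $P_i$ be the orthogonal projection matrix onto $\ker A_i$. Suppose each agent $i$ has event times $t_{i1}<t_{i2}<\cdots$ and a state $x_i(t)$ with $A_ix_i(t_{i1})=b_i$, and updates its state asynchronously according to the rule $$x_i(t_{i(k+1)})=x_i(t_{ik})-\frac{1}{m_i(t_{ik})}P_i\Bigl(m_i(t_{ik})x_i(t_{ik})-\sum_{j\in\mathcal{N}_i(t_{ik})}x_j(t_{ik})\Bigr),\qquad k\ge1,$$ where $m_i(t_{ik})$ is the number of labels in $\mathcal{N}_i(t_{ik})$. Suppose in addition that the sequence of extended neighbor graphs $\bar{\mathbb{N}}(p)$, $p\ge1$, is repeatedly jointly strongly connected. Then there exists a positive constant $\lambda<1$ for which all $x_i(t_p)$ converge to the same solution to $Ax=b$ as $p\to\infty$, as fast as $\lambda^p$ converges to $0$.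
   Context: Asynchronous setting. Time $t$ takes values in $[0,\infty)$. Agent $i\in\{1,\dots,m\}$ has a strictly increasing infinite sequence of event times $t_{i1},t_{i2},\dots$; $t_{i1}$ is the time agent $i$ initializes its state and $t_{ik}$, $k>1$, are the times at which it updates its state. The state $x_i(t)\in\mathbb{R}^n$ is constant on each half-open interval $[t_{ik},t_{i(k+1)})$, $k\ge1$. There are positive numbers $\bar T_i>T_i$ with $\bar T_i\ge t_{i(k+1)}-t_{ik}\ge T_i$ for all $k\ge1$. No relation between event times of different agents is assumed. For $k>1$, $\mathcal{N}_i(t_{ik})$ is the set of labels of agent $i$'s neighbors at time $t_{ik}$, i.e. of agents whose state $x_j(t_{ik})$ is available (without delay) to agent $i$ at time $t_{ik}$; always $i\in\mathcal{N}_i(t_{ik})$. For $k=1$, $\mathcal{N}_i(t_{i1})=\{i\}$. Common time scale: let $t_1=\max_i t_{i1}$, let $\mathcal{T}$ be the set of all event times of all $m$ agents which are $\ge t_1$, and label its elements $t_1<t_2<\cdots<t_p<\cdots$. The extended neighbor set $\bar{\mathcal{N}}_i(p)$ is $\mathcal{N}_i(t_p)$ if $t_p$ is an event time of agent $i$, and $\{i\}$ otherwise. The extended neighbor graph $\bar{\mathbb{N}}(p)$ is the directed graph on $\{1,\dots,m\}$ with an arc from $j$ to $i$ exactly when $j\in\bar{\mathcal{N}}_i(p)$. $\mathcal{G}_{sa}$ is the set of directed graphs on $\{1,\dots,m\}$ with self-arcs at all vertices. For $\mathbb{G}_p,\mathbb{G}_q\in\mathcal{G}_{sa}$ the composition $\mathbb{G}_q\circ\mathbb{G}_p\in\mathcal{G}_{sa}$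 has $(i,j)$ as an arc exactly when there is a vertex $k$ such that $(i,k)$ is an arc in $\mathbb{G}_p$ and $(k,j)$ is an arc in $\mathbb{G}_q$; composition is associative. An infinite sequence $\mathbb{G}_1,\mathbb{G}_2,\dots$ in $\mathcal{G}_{sa}$ is repeatedly jointly strongly connected if for some positive integers $l$ and $\tau_0$ and each integer $k>0$ the composed graph $\mathbb{G}_{kl+\tau_0-1}\circ\mathbb{G}_{kl+\tau_0-2}\circ\cdots\circ\mathbb{G}_{(k-1)l+\tau_0}$ is strongly connected. "$x_i(t_p)$ converges to $x^\infty$ as fast as $\lambda^p$ converges to $0$" means that there is a constant $c$ with $|x_i(t_p)-x^\infty|_2\le c\lambda^p$ for all $p\ge1$. *)

theory Defs
  imports
    "Graph_Theory.Digraph_Component"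
    "Graph_Theory.Pair_Digraph"
    "HOL-Analysis.Analysis"
begin

text \<open>
  The number of rows of the matrix of agent \<open>i\<close> depends on \<open>i\<close>, so it cannot be a type-level
  dimension. A matrix with columns indexed by the finite type \<open>'n\<close> is represented by the list of
  its rows, and a right-hand side by the list of its entries; stacking is then \<^const>\<open>concat\<close>.
\<close>

definition mult_rows :: "(real^'n) list \<Rightarrow> real^'n \<Rightarrow> real list" where
  "mult_rows M x = map (\<lambda>r. r \<bullet> x) M"

definition kernel_rows :: "(real^'n) list \<Rightarrow> (real^'n) set" where
  "kernel_rows M = {x. mult_rows M x = replicate (length M) 0}"

definition stack :: "nat \<Rightarrow> (nat \<Rightarrow> 'a list) \<Rightarrow> 'a list" where
  "stack m B = concat (map B [1..<Suc m])"

definition orthogonal_projection_matrix :: "real^'n^'n \<Rightarrow> (real^'n) set \<Rightarrow> bool" where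
  "orthogonal_projection_matrix P S \<longleftrightarrow>
     (\<forall>x. P *v x \<in> S \<and> (\<forall>y\<in>S. orthogonal (x - P *v x) y))"

text \<open>
  \<open>graph_comp H G\<close> is \<open>H \<circ> G\<close>: first an arc of \<open>G\<close>, then one of \<open>H\<close>. The relational product
  takes its arguments in the opposite order.
\<close>

definition graph_comp :: "'a pair_pre_digraph \<Rightarrow> 'a pair_pre_digraph \<Rightarrow> 'a pair_pre_digraph" where
  "graph_comp H G = \<lparr>pverts = pverts G, parcs = parcs G O parcs H\<rparr>"

text \<open>\<open>joint_graph G a d\<close> is \<open>G (a + d) \<circ> \<dots> \<circ> G (a + 1) \<circ> G a\<close>, a composition of \<open>d + 1\<close> graphs.\<close>

primrec joint_graph :: "(nat \<Rightarrow> 'a pair_pre_digraph) \<Rightarrow> nat \<Rightarrow> nat \<Rightarrow> 'a pair_pre_digraph" where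
  "joint_graph G a 0 = G a"
| "joint_graph G a (Suc d) = graph_comp (G (a + Suc d)) (joint_graph G a d)"

definition repeatedly_jointly_strongly_connected :: "(nat \<Rightarrow> 'a pair_pre_digraph) \<Rightarrow> bool" where
  "repeatedly_jointly_strongly_connected G \<longleftrightarrow>
     (\<exists>l\<ge>1. \<exists>\<tau>\<^sub>0\<ge>1. \<forall>k\<ge>1.
        strongly_connected (with_proj (joint_graph G ((k - 1) * l + \<tau>\<^sub>0) (l - 1))))"

text \<open>
  Below, \<open>ev i k\<close> is the \<open>k\<close>-th event time of agent \<open>i\<close> and \<open>t p\<close> the \<open>p\<close>-th element of the
  common time scale. Agents are numbered from 1 to \<open>m\<close>, and all sequences start at index 1; their
  values at index 0 are irrelevant.
\<close>

definition event_times :: "(nat \<Rightarrow> nat \<Rightarrow> real) \<Rightarrow> nat \<Rightarrow> real set" where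
  "event_times ev i = {ev i k |k. 1 \<le> k}"

definition common_times :: "nat \<Rightarrow> (nat \<Rightarrow> nat \<Rightarrow> real) \<Rightarrow> real set" where
  "common_times m ev =
     {s \<in> (\<Union>i\<in>{1..m}. event_times ev i). (MAX i\<in>{1..m}. ev i 1) \<le> s}"

definition increasing_labeling :: "(nat \<Rightarrow> real) \<Rightarrow> real set \<Rightarrow> bool" where
  "increasing_labeling t S \<longleftrightarrow> strict_mono_on {1..} t \<and> t ` {1..} = S"

definition ext_nbrs ::
    "(nat \<Rightarrow> nat \<Rightarrow> real) \<Rightarrow> (nat \<Rightarrow> real) \<Rightarrow> (nat \<Rightarrow> real \<Rightarrow> nat set) \<Rightarrow> nat \<Rightarrow> nat \<Rightarrow> nat set" where
  "ext_nbrs ev t N i p = (if t p \<in> event_times ev i then N i (t p) else {i})"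

definition ext_nbr_graph ::
    "nat \<Rightarrow> (nat \<Rightarrow> nat \<Rightarrow> real) \<Rightarrow> (nat \<Rightarrow> real) \<Rightarrow> (nat \<Rightarrow> real \<Rightarrow> nat set) \<Rightarrow>
     nat \<Rightarrow> nat pair_pre_digraph" where
  "ext_nbr_graph m ev t N p =
     \<lparr>pverts = {1..m},
      parcs = {(j, i). i \<in> {1..m} \<and> j \<in> {1..m} \<and> j \<in> ext_nbrs ev t N i p}\<rparr>"

definition converges_as_fast_as ::
    "(nat \<Rightarrow> 'a::real_normed_vector) \<Rightarrow> 'a \<Rightarrow> real \<Rightarrow> bool" where
  "converges_as_fast_as y z q \<longleftrightarrow> (\<exists>c. \<forall>p\<ge>1. norm (y p - z) \<le> c * q ^ p)"

end

theory Submission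
  imports Defs
begin

text \<open>
  Fix a solution and let \<open>u i p\<close> be the state that agent \<open>i\<close> adopts at its first event time after
  \<open>t p\<close>, relative to that solution. Then \<open>u i p\<close> is the projection onto the kernel of agent \<open>i\<close> of the
  mean of the values \<open>u j (s i j p)\<close> over the extended neighbours \<open>j\<close>, where the delays \<open>p - s i j p\<close>
  are bounded because the event gaps are. If \<open>w\<close> is the projection of the mean of \<open>e 1, \<dots>, e n\<close> onto
  a subspace containing \<open>v\<close>, then \<open>|w - v|\<^sup>2\<close> is the mean of \<open>|e j - v|\<^sup>2 - |e j - w|\<^sup>2\<close>. Hence,
  for \<open>v\<close> in the common kernel, the bound \<open>r = max |u i p - v|\<close> never grows, and if it fails to
  shrink by a definite factor over a long time window, then some state \<open>f\<close> at the end of the window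
  is close to every state that influenced it. By joint connectivity these are states of all agents, so
  \<open>f\<close> is close to every kernel and by linear regularity to the common kernel. All states are then
  within \<open>r / 2\<close> of a point of the common kernel, which is again a contraction.
\<close>

subsection \<open>Projected means and linear regularity\<close>

text \<open>After expanding the squares, the sum depends on \<open>e\<close> only through its mean
  \<open>a\<close>. Orthogonality of \<open>a - w\<close> to \<open>w - v\<close>, which lies in
  \<open>S\<close>, then replaces \<open>a\<close> by \<open>w\<close>.\<close>

lemma norm_diff_project_mean:
  fixes e :: "'j \<Rightarrow> 'v::real_inner"
  assumes J: "finite J" "J \<noteq> {}"
    and S: "subspace S" "v \<in> S" "w \<in> S"
    and orth: "\<And>y. y \<in> S \<Longrightarrow> ((1 / real (card J)) *\<^sub>R (\<Sum>j\<in>J. e j) - w) \<bullet> y = 0"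
  shows "(norm (w - v))\<^sup>2 = (\<Sum>j\<in>J. (norm (e j - v))\<^sup>2 - (norm (e j - w))\<^sup>2) / card J"
proof -
  define a where "a = (1 / real (card J)) *\<^sub>R (\<Sum>j\<in>J. e j)"
  have card: "real (card J) > 0" using J by (simp add: card_gt_0_iff)
  then have sum_e: "(\<Sum>j\<in>J. e j) = real (card J) *\<^sub>R a" by (simp add: a_def)
  have "(a - w) \<bullet> (w - v) = 0"
    using orth S by (simp add: a_def subspace_diff)
  then have aw: "a \<bullet> w - a \<bullet> v = w \<bullet> w - w \<bullet> v" by (simp add: inner_simps)
  have "(\<Sum>j\<in>J. (norm (e j - v))\<^sup>2 - (norm (e j - w))\<^sup>2)
      = (\<Sum>j\<in>J. 2 * (e j \<bullet> (w - v)) + (v \<bullet> v - w \<bullet> w))"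
    by (intro sum.cong) (simp_all add: power2_norm_eq_inner inner_simps inner_commute)
  also have "\<dots> = 2 * ((\<Sum>j\<in>J. e j) \<bullet> (w - v)) + card J * (v \<bullet> v - w \<bullet> w)"
    by (simp add: sum.distrib sum_distrib_left inner_sum_left)
  also have "\<dots> = card J * (2 * (a \<bullet> w - a \<bullet> v) + v \<bullet> v - w \<bullet> w)"
    by (simp add: sum_e inner_simps algebra_simps)
  also have "\<dots> = card J * (norm (w - v))\<^sup>2"
    by (simp add: aw power2_norm_eq_inner inner_simps inner_commute)
  finally show ?thesis using card by simp
qed

lemma norm_diff_triangle_power2:
  fixes x y z :: "'v::real_normed_vector"
  shows "(norm (x - z))\<^sup>2 \<le> 2 * ((norm (x - y))\<^sup>2 + (norm (y - z))\<^sup>2)"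
proof -
  have "(norm (x - z))\<^sup>2 \<le> (norm (x - y) + norm (y - z))\<^sup>2"
    using norm_triangle_ineq[of "x - y" "y - z"] by (intro power_mono) auto
  also have "\<dots> \<le> 2 * ((norm (x - y))\<^sup>2 + (norm (y - z))\<^sup>2)"
    using sum_squares_bound[of "norm (x - y)" "norm (y - z)"] by (simp add: power2_sum)
  finally show ?thesis .
qed

text \<open>The residuals of the projections onto the \<open>S i\<close> add up to a linear map
  \<open>G\<close> that is injective on the orthogonal complement of the intersection, hence bounded
  below there. Being close to every \<open>S i\<close> makes \<open>G f\<close> small.\<close>

lemma subspaces_linearly_regular:
  fixes S :: "'i \<Rightarrow> 'v::euclidean_space set"
  assumes fin: "finite I" and S: "\<And>i. i \<in> I \<Longrightarrow> subspace (S i)"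
  obtains \<kappa> where "\<kappa> \<ge> 0"
    and "\<And>f \<eta>. \<lbrakk>\<eta> \<ge> 0; \<And>i. i \<in> I \<Longrightarrow> \<exists>g\<in>S i. norm (f - g) \<le> \<eta>\<rbrakk>
      \<Longrightarrow> \<exists>v\<in>(\<Inter>i\<in>I. S i). norm (f - v) \<le> \<kappa> * \<eta>"
proof -
  define K where "K = (\<Inter>i\<in>I. S i)"
  have K: "subspace K" unfolding K_def by (rule subspace_Inter) (auto simp: S)
  have "\<exists>R. linear R \<and> (\<forall>f. f - R f \<in> S i \<and> (\<forall>y\<in>S i. R f \<bullet> y = 0))" if i: "i \<in> I" for i
  proof -
    obtain B where B: "B \<subseteq> S i" "pairwise orthogonal B" "span B = S i" "finite B"
      "\<And>x. x \<in> B \<Longrightarrow> norm x = 1"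
      using orthonormal_basis_subspace[OF S[OF i]]
      by (metis finiteI_independent)
    \<comment> \<open>Residual of the orthogonal projection onto \<open>S i\<close>, written in an
      orthonormal basis.\<close>
    define R where "R f = f - (\<Sum>b\<in>B. (f \<bullet> b) *\<^sub>R b)" for f
    have "linear R"
      by (rule linearI)
        (simp_all add: R_def inner_simps algebra_simps sum.distrib scaleR_sum_right)
    moreover have "f - R f \<in> S i" for f
      unfolding R_def using B(1) S[OF i] by (auto intro!: subspace_sum subspace_scale)
    moreover have "R f \<bullet> y = 0" if "y \<in> S i" for f y
    proof -
      have "R f \<bullet> b = 0" if b: "b \<in> B" for b
      proof -
        have "(\<Sum>c\<in>B. (f \<bullet> c) *\<^sub>R c) \<bullet> b = (\<Sum>c\<in>B. if c = b then f \<bullet> b else 0)"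
          unfolding inner_sum_left
          using B(2,5) b
          by (intro sum.cong) (auto simp: pairwise_def orthogonal_def norm_eq_1)
        then show ?thesis using B(4) b by (simp add: R_def inner_simps)
      qed
      then have "orthogonal (R f) b" if "b \<in> B" for b using that by (simp add: orthogonal_def)
      then have "orthogonal (R f) y" using that B(3) orthogonal_to_span by blast
      then show ?thesis by (simp add: orthogonal_def)
    qed
    ultimately show ?thesis by blast
  qed
  then obtain R where R: "\<And>i. i \<in> I \<Longrightarrow> linear (R i)"
    and R_mem: "\<And>i f. i \<in> I \<Longrightarrow> f - R i f \<in> S i"
    and R_orth: "\<And>i f y. i \<in> I \<Longrightarrow> y \<in> S i \<Longrightarrow> R i f \<bullet> y = 0"
    by metis
  have R_norm: "f \<bullet> R i f = (norm (R i f))\<^sup>2" if "i \<in> I" for i f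
    using R_orth[OF that R_mem[OF that, of f], of f]
    by (simp add: power2_norm_eq_inner inner_simps inner_commute)
  have R_le: "norm (R i f) \<le> norm (f - g)" if i: "i \<in> I" and g: "g \<in> S i" for i f g
  proof -
    have "f - R i f - g \<in> S i" using subspace_diff[OF S[OF i] R_mem[OF i] g] .
    then have "R i f \<bullet> (f - R i f - g) = 0" using R_orth[OF i] by blast
    then have "(norm (R i f))\<^sup>2 + (norm (f - R i f - g))\<^sup>2 = (norm (f - g))\<^sup>2"
      by (simp add: power2_norm_eq_inner inner_simps inner_commute)
    then have "(norm (R i f))\<^sup>2 \<le> (norm (f - g))\<^sup>2" by (smt (verit) zero_le_power2)
    then show ?thesis by (simp add: power2_le_iff_abs_le)
  qed
  define G where "G f = (\<Sum>i\<in>I. R i f)" for f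
  define T where "T = {f. \<forall>y\<in>K. f \<bullet> y = 0}"
  have G: "linear G" unfolding G_def by (intro linear_compose_sum) (auto simp: R)
  have T: "subspace T" unfolding T_def by (auto simp: subspace_def inner_simps)
  \<comment> \<open>\<open>G\<close> is a sum of positive semidefinite maps, so
    \<open>G f = 0\<close> annihilates every single residual and puts \<open>f\<close> into
    \<open>K\<close>; but \<open>T\<close> is the orthogonal complement of \<open>K\<close>.\<close>
  have "f = 0" if "f \<in> T" "G f = 0" for f
  proof -
    have "(\<Sum>i\<in>I. (norm (R i f))\<^sup>2) = f \<bullet> G f"
      by (simp add: G_def inner_sum_right R_norm)
    then have "\<forall>i\<in>I. R i f = 0"
      using that(2) fin by (simp add: sum_nonneg_eq_0_iff)
    then have "f \<in> K" unfolding K_def using R_mem[of _ f] by auto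
    then show ?thesis using that(1) by (auto simp: T_def)
  qed
  then obtain e where e: "e > 0" "\<And>f. f \<in> T \<Longrightarrow> norm (G f) \<ge> e * norm f"
    using injective_imp_isometric[of T G] T G
    by (metis closed_subspace linear_conv_bounded_linear)
  show thesis
  \<comment> \<open>\<open>card I\<close> comes from the triangle inequality over the residuals,
    \<open>1 / e\<close> from the lower bound of \<open>G\<close> on \<open>T\<close>.\<close>
  proof (rule that[of "card I / e"])
    show "0 \<le> card I / e" using e by simp
    fix f \<eta> assume \<eta>: "\<eta> \<ge> (0::real)" and near: "\<And>i. i \<in> I \<Longrightarrow> \<exists>g\<in>S i. norm (f - g) \<le> \<eta>"
    \<comment> \<open>The component \<open>k\<close> in \<open>K\<close> has no residuals, so
      \<open>G f\<close> sees only \<open>h = f - k\<close>.\<close>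
    obtain k h where k: "k \<in> span K" and h: "\<And>w. w \<in> span K \<Longrightarrow> orthogonal h w" and f: "f = k + h"
      using orthogonal_subspace_decomp_exists[of K f] by metis
    have k: "k \<in> K" using k K by (metis span_eq_iff)
    have hT: "h \<in> T" using h span_base by (fastforce simp: T_def orthogonal_def)
    have "R i k = 0" if "i \<in> I" for i
      using R_le[OF that, of k k] k that by (auto simp: K_def)
    then have "G k = 0" by (simp add: G_def)
    then have "G f = G h" using G f by (simp add: linear_add)
    then have "e * norm h \<le> norm (G f)" using e(2)[OF hT] by simp
    also have "\<dots> \<le> (\<Sum>i\<in>I. norm (R i f))" unfolding G_def by (rule norm_sum)
    also have "\<dots> \<le> (\<Sum>i\<in>I. \<eta>)"
      using near R_le by (intro sum_mono) (meson order_trans)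
    finally have "norm (f - k) \<le> card I / e * \<eta>"
      using e f by (simp add: field_simps)
    then show "\<exists>v\<in>\<Inter>i\<in>I. S i. norm (f - v) \<le> card I / e * \<eta>"
      using k K_def by blast
  qed
qed

subsection \<open>Projected averaging with bounded delays\<close>

text \<open>\<open>mem\<close> and \<open>step\<close> together say that \<open>u i p\<close> is the
  orthogonal projection of the neighbours' mean onto \<open>S i\<close>. \<open>s i j p\<close> is
  the index of the value of \<open>j\<close> entering that mean; an agent's own delay is exactly
  one, so that influence, once received, is passed on at every step. \<open>conn\<close> is joint
  connectivity in terms of cuts.\<close>

locale delayed_projected_consensus =
  fixes I :: "'i set" and S :: "'i \<Rightarrow> 'v::euclidean_space set"
    and u :: "'i \<Rightarrow> nat \<Rightarrow> 'v" and nb :: "'i \<Rightarrow> nat \<Rightarrow> 'i set"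
    and s :: "'i \<Rightarrow> 'i \<Rightarrow> nat \<Rightarrow> nat" and B W p0 :: nat
  assumes fin: "finite I" and ne: "I \<noteq> {}"
    and subsp: "\<And>i. i \<in> I \<Longrightarrow> subspace (S i)"
    and mem: "\<And>i p. i \<in> I \<Longrightarrow> u i p \<in> S i"
    and nb_sub: "\<And>i p. i \<in> I \<Longrightarrow> p0 < p \<Longrightarrow> nb i p \<subseteq> I"
    and nb_self: "\<And>i p. i \<in> I \<Longrightarrow> p0 < p \<Longrightarrow> i \<in> nb i p"
    and s_self: "\<And>i p. i \<in> I \<Longrightarrow> p0 < p \<Longrightarrow> s i i p = p - 1"
    and s_less: "\<And>i j p. i \<in> I \<Longrightarrow> p0 < p \<Longrightarrow> j \<in> nb i p \<Longrightarrow> s i j p < p"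
    and s_ge: "\<And>i j p. i \<in> I \<Longrightarrow> p0 < p \<Longrightarrow> j \<in> nb i p \<Longrightarrow> p \<le> s i j p + B"
    and step: "\<And>i p y. i \<in> I \<Longrightarrow> p0 < p \<Longrightarrow> y \<in> S i \<Longrightarrow>
        ((1 / real (card (nb i p))) *\<^sub>R (\<Sum>j\<in>nb i p. u j (s i j p)) - u i p) \<bullet> y = 0"
    and conn: "\<And>J a. J \<subseteq> I \<Longrightarrow> J \<noteq> {} \<Longrightarrow> J \<noteq> I \<Longrightarrow> p0 \<le> a \<Longrightarrow>
        \<exists>p. a < p \<and> p \<le> a + W \<and> (\<exists>i\<in>I - J. \<exists>j\<in>J. j \<in> nb i p)"
begin

abbreviation K :: "'v set" where "K \<equiv> \<Inter>i\<in>I. S i"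

definition near :: "'v \<Rightarrow> real \<Rightarrow> nat \<Rightarrow> bool" where
  "near v r a \<longleftrightarrow> (\<forall>i\<in>I. \<forall>p\<ge>a. norm (u i p - v) \<le> r)"

section \<open>Deficits and invariant balls\<close>

lemma card_nb: "i \<in> I \<Longrightarrow> p0 < p \<Longrightarrow> 0 < card (nb i p) \<and> card (nb i p) \<le> card I"
  using nb_sub nb_self fin by (metis card_gt_0_iff card_mono empty_iff finite_subset)

lemma finite_nb: "i \<in> I \<Longrightarrow> p0 < p \<Longrightarrow> finite (nb i p)"
  using nb_sub fin finite_subset by blast

lemma B_pos: "0 < B"
proof -
  obtain i where i: "i \<in> I" using ne by blast
  have "Suc p0 \<le> s i i (Suc p0) + B" using s_ge[OF i _ nb_self[OF i]] by simp
  then show ?thesis using s_self[OF i] by simp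
qed

text \<open>By \<open>norm_diff_project_mean\<close> the new deficit is the mean over all neighbours
  of nonnegative terms; one term is kept, and the number of neighbours is at most
  \<open>card I\<close>.\<close>

lemma deficit_step:
  assumes i: "i \<in> I" and p: "p0 < p" and v: "v \<in> K" and j: "j \<in> nb i p"
    and bound: "\<And>j. j \<in> nb i p \<Longrightarrow> norm (u j (s i j p) - v) \<le> r"
  shows "r\<^sup>2 - (norm (u i p - v))\<^sup>2 \<ge> (1 / card I) *
    (r\<^sup>2 - (norm (u j (s i j p) - v))\<^sup>2 + (norm (u j (s i j p) - u i p))\<^sup>2)"
proof -
  let ?n = "real (card (nb i p))"
  let ?D = "\<lambda>j. r\<^sup>2 - (norm (u j (s i j p) - v))\<^sup>2 + (norm (u j (s i j p) - u i p))\<^sup>2"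
  have n: "0 < ?n" "?n \<le> card I" using card_nb[OF i p] by auto
  have D: "0 \<le> ?D j" if "j \<in> nb i p" for j
    using power_mono[OF bound[OF that] norm_ge_zero, of 2] by simp
  have "v \<in> S i" using v i by blast
  then have "(norm (u i p - v))\<^sup>2
      = (\<Sum>j\<in>nb i p. (norm (u j (s i j p) - v))\<^sup>2 - (norm (u j (s i j p) - u i p))\<^sup>2) / ?n"
    using norm_diff_project_mean[OF finite_nb[OF i p] _ subsp[OF i] _ mem[OF i] step[OF i p]] j
    by blast
  also have "\<dots> = (\<Sum>j\<in>nb i p. r\<^sup>2 - ?D j) / ?n" by simp
  also have "\<dots> = r\<^sup>2 - (\<Sum>j\<in>nb i p. ?D j) / ?n"
    using n by (simp only: sum_subtractf) (simp add: diff_divide_distrib)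
  finally have "r\<^sup>2 - (norm (u i p - v))\<^sup>2 = (\<Sum>j\<in>nb i p. ?D j) / ?n" by simp
  also have "\<dots> \<ge> ?D j / ?n"
    using member_le_sum[OF j, of ?D] D finite_nb[OF i p] n by (simp add: divide_right_mono)
  moreover have "?D j / ?n \<ge> (1 / card I) * ?D j"
    using D[OF j] n by (simp add: frac_le)
  ultimately show ?thesis by linarith
qed

text \<open>Values are computed from values at most \<open>B\<close> steps older, so
  \<open>B + 1\<close> consecutive indices determine what follows, and projected means do not leave
  a ball centred in \<open>K\<close>.\<close>

lemma nearI:
  assumes v: "v \<in> K" and a: "p0 \<le> a" and r: "0 \<le> r"
    and window: "\<And>i p. i \<in> I \<Longrightarrow> a \<le> p \<Longrightarrow> p \<le> a + B \<Longrightarrow> norm (u i p - v) \<le> r"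
  shows "near v r a"
proof -
  have "\<forall>i\<in>I. a \<le> p \<longrightarrow> norm (u i p - v) \<le> r" for p
  proof (induction p rule: less_induct)
    case (less p)
    show ?case
    proof (intro ballI impI)
      fix i assume i: "i \<in> I" and ap: "a \<le> p"
      show "norm (u i p - v) \<le> r"
      proof (cases "p \<le> a + B")
        case True
        then show ?thesis using window i ap by blast
      next
        case False
        then have p: "p0 < p" using a by simp
        have bound: "norm (u j (s i j p) - v) \<le> r" if j: "j \<in> nb i p" for j
        proof -
          have "j \<in> I" "s i j p < p" "a \<le> s i j p"
            using nb_sub[OF i p] j s_less[OF i p j] s_ge[OF i p j] False by auto
          then show ?thesis using less.IH by blast
        qed
        \<comment> \<open>Any neighbour would serve here; the agent itself is always one.\<close>
        have "0 \<le> r\<^sup>2 - (norm (u i (s i i p) - v))\<^sup>2"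
          using power_mono[OF bound[OF nb_self[OF i p]] norm_ge_zero, of 2] by simp
        then have "0 \<le> (1 / card I) *
            (r\<^sup>2 - (norm (u i (s i i p) - v))\<^sup>2 + (norm (u i (s i i p) - u i p))\<^sup>2)"
          by (intro mult_nonneg_nonneg) auto
        also have "\<dots> \<le> r\<^sup>2 - (norm (u i p - v))\<^sup>2"
          using deficit_step[OF i p v nb_self[OF i p] bound] by blast
        finally show ?thesis using r by (simp add: power2_le_iff_abs_le)
      qed
    qed
  qed
  then show ?thesis by (auto simp: near_def)
qed

section \<open>Traces of earlier states\<close>

definition weight :: real where "weight = 1 / (2 * card I)"

text \<open>The trace left on \<open>f\<close> by a state \<open>g\<close> from which it is computed in \<open>n\<close> averaging steps while all
  states are within \<open>r\<close> of \<open>v\<close>. If \<open>f\<close> is almost at distance \<open>r\<close> from \<open>v\<close>, then \<open>g\<close> is close to \<open>f\<close>.\<close>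

definition infl :: "'v \<Rightarrow> real \<Rightarrow> nat \<Rightarrow> 'v \<Rightarrow> 'v \<Rightarrow> bool" where
  "infl v r n g f \<longleftrightarrow> weight ^ n * (r\<^sup>2 - (norm (g - v))\<^sup>2 + (norm (g - f))\<^sup>2) \<le> r\<^sup>2 - (norm (f - v))\<^sup>2"

lemma weight: "0 < weight" "weight \<le> 1"
proof -
  have "0 < card I" using fin ne by (simp add: card_gt_0_iff)
  then show "0 < weight" "weight \<le> 1" by (auto simp: weight_def field_simps)
qed

lemma weight_double: "weight * 2 = 1 / card I"
  by (simp add: weight_def)

lemma infl_refl: "infl v r 0 g g"
  by (simp add: infl_def)

lemma infl_mono:
  assumes "infl v r n g f" "n \<le> n'" "norm (g - v) \<le> r"
  shows "infl v r n' g f"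
proof -
  have "0 \<le> r\<^sup>2 - (norm (g - v))\<^sup>2 + (norm (g - f))\<^sup>2"
    using power_mono[OF assms(3) norm_ge_zero, of 2] by simp
  moreover have "weight ^ n' \<le> weight ^ n" using weight assms(2) by (intro power_decreasing) auto
  ultimately have "weight ^ n' * (r\<^sup>2 - (norm (g - v))\<^sup>2 + (norm (g - f))\<^sup>2)
      \<le> weight ^ n * (r\<^sup>2 - (norm (g - v))\<^sup>2 + (norm (g - f))\<^sup>2)"
    by (rule mult_right_mono[rotated])
  then show ?thesis using assms(1) by (simp add: infl_def)
qed

text \<open>\<open>deficit_step\<close> hands the deficit of the neighbour's state on to
  \<open>u i p\<close>, together with the squared displacement between the two. The triangle
  inequality merges this with the distance to \<open>g\<close> at the cost of a factor 2, which is
  why \<open>weight\<close> is half of \<open>1 / card I\<close>.\<close>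

lemma infl_step:
  assumes near: "near v r a" and v: "v \<in> K" and i: "i \<in> I" and p: "p0 < p" "a + B \<le> p"
    and j: "j \<in> nb i p" and g: "norm (g - v) \<le> r"
    and infl: "infl v r n g (u j (s i j p))"
  shows "infl v r (Suc n) g (u i p)"
proof -
  let ?f = "u j (s i j p)"
  have G: "0 \<le> r\<^sup>2 - (norm (g - v))\<^sup>2"
    using power_mono[OF g norm_ge_zero, of 2] by simp
  have bound: "norm (u k (s i k p) - v) \<le> r" if k: "k \<in> nb i p" for k
  proof -
    have "k \<in> I" "a \<le> s i k p" using nb_sub[OF i p(1)] k s_ge[OF i p(1) k] p(2) by auto
    then show ?thesis using near by (simp add: near_def)
  qed
  have wn: "0 \<le> weight ^ n" "weight ^ n \<le> 1" using weight by (auto intro: power_le_one)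
  have "r\<^sup>2 - (norm (g - v))\<^sup>2 + (norm (g - u i p))\<^sup>2
      \<le> 2 * (r\<^sup>2 - (norm (g - v))\<^sup>2 + (norm (g - ?f))\<^sup>2 + (norm (?f - u i p))\<^sup>2)"
    using norm_diff_triangle_power2[of g "u i p" ?f] G by argo
  then have "weight ^ n * (r\<^sup>2 - (norm (g - v))\<^sup>2 + (norm (g - u i p))\<^sup>2)
      \<le> weight ^ n * (2 * (r\<^sup>2 - (norm (g - v))\<^sup>2 + (norm (g - ?f))\<^sup>2 + (norm (?f - u i p))\<^sup>2))"
    by (rule mult_left_mono[OF _ wn(1)])
  also have "\<dots> = 2 * (weight ^ n * (r\<^sup>2 - (norm (g - v))\<^sup>2 + (norm (g - ?f))\<^sup>2)
      + weight ^ n * (norm (?f - u i p))\<^sup>2)" by algebra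
  also have "\<dots> \<le> 2 * (r\<^sup>2 - (norm (?f - v))\<^sup>2 + (norm (?f - u i p))\<^sup>2)"
    using infl mult_right_mono[OF wn(2), of "(norm (?f - u i p))\<^sup>2"] by (simp add: infl_def)
  finally have "weight * (weight ^ n * (r\<^sup>2 - (norm (g - v))\<^sup>2 + (norm (g - u i p))\<^sup>2))
      \<le> weight * (2 * (r\<^sup>2 - (norm (?f - v))\<^sup>2 + (norm (?f - u i p))\<^sup>2))"
    using weight by (intro mult_left_mono) auto
  also have "\<dots> = (1 / card I) * (r\<^sup>2 - (norm (?f - v))\<^sup>2 + (norm (?f - u i p))\<^sup>2)"
    by (simp only: mult.assoc[symmetric] weight_double)
  also have "\<dots> \<le> r\<^sup>2 - (norm (u i p - v))\<^sup>2"
    using deficit_step[OF i p(1) v j bound] by blast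
  finally show ?thesis by (simp add: infl_def mult.assoc)
qed

text \<open>The set \<open>R q\<close> of agents carrying the trace never shrinks, since every agent
  averages over its own previous value. In each block of length \<open>B + W\<close> an arc leaves
  it, so it gains an agent until it is all of \<open>I\<close>.\<close>

lemma infl_eventually_all:
  assumes near: "near v r a" and v: "v \<in> K" and a: "p0 \<le> a"
    and j: "j \<in> I" and p: "a + B \<le> p" and i: "i \<in> I" and q: "p + card I * (B + W) \<le> q"
  shows "infl v r (q - p) (u j p) (u i q)"
proof -
  define R where "R q = {i\<in>I. infl v r (q - p) (u j p) (u i q)}" for q
  have g: "norm (u j p - v) \<le> r" using near j p by (simp add: near_def)
  have step: "k \<in> R q" if k: "k \<in> I" and q: "p < q" and l: "l \<in> nb k q" and s: "p \<le> s k l q"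
    and R: "l \<in> R (s k l q)" for k l q
  proof -
    have q': "p0 < q" "a + B \<le> q" using a p q by auto
    have "infl v r (Suc (s k l q - p)) (u j p) (u k q)"
      using infl_step[OF near v k q' l g] R by (simp add: R_def)
    \<comment> \<open>Each averaging step advances the index by at least one, so the elapsed time
      bounds the number of steps.\<close>
    moreover have "Suc (s k l q - p) \<le> q - p" using s_less[OF k q'(1) l] s by simp
    ultimately show ?thesis using infl_mono g k by (auto simp: R_def)
  qed
  have R_Suc: "R q \<subseteq> R (Suc q)" if q: "p \<le> q" for q
  proof
    fix k assume k: "k \<in> R q"
    then have kI: "k \<in> I" by (simp add: R_def)
    have "p0 < Suc q" using q a p by simp
    then have "s k k (Suc q) = q" "k \<in> nb k (Suc q)" using s_self nb_self kI by auto
    then show "k \<in> R (Suc q)" using step[of k "Suc q" k] kI k q by auto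
  qed
  have R_mono: "R q \<subseteq> R q'" if "p \<le> q" "q \<le> q'" for q q'
    using that(2,1) by (induction q' rule: dec_induct) (use R_Suc le_trans in blast)+
  have j0: "j \<in> R p" using j infl_refl by (simp add: R_def)
  have R_I: "R q \<subseteq> I" for q by (auto simp: R_def)
  have "n \<le> card (R (p + n * (B + W))) \<or> R (p + n * (B + W)) = I" for n
  proof (induction n)
    case (Suc n)
    define q where "q = p + n * (B + W)"
    have pq: "p \<le> q" by (simp add: q_def)
    have q2: "p + Suc n * (B + W) = q + B + W" by (simp add: q_def)
    show ?case
    proof (cases "R q = I")
      case True
      then show ?thesis using R_mono[OF pq, of "q + B + W"] R_I unfolding q2 by auto
    next
      case False
      have "R q \<noteq> {}" using R_mono[OF order_refl pq] j0 by auto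
      \<comment> \<open>The arc is sought only after \<open>q + B\<close>, so that the delayed value
        it transports has index at least \<open>q\<close> and already carries the trace.\<close>
      moreover have "p0 \<le> q + B" using a p pq by simp
      ultimately obtain q' k l where q': "q + B < q'" "q' \<le> q + B + W"
        and k: "k \<in> I" "k \<notin> R q" and l: "l \<in> R q" "l \<in> nb k q'"
        using conn[of "R q" "q + B"] R_I False by blast
      have "p0 < q'" using q' \<open>p0 \<le> q + B\<close> by simp
      then have sq: "q \<le> s k l q'" using s_ge[OF k(1) _ l(2)] q' by fastforce
      then have "l \<in> R (s k l q')" using R_mono[OF pq sq] l by blast
      then have "k \<in> R q'" using step[OF k(1) _ l(2)] sq pq q' by simp
      then have "k \<in> R (q + B + W)" using R_mono[of q' "q + B + W"] q' pq by auto
      then have "R q \<subset> R (q + B + W)" using k R_mono[OF pq, of "q + B + W"] by auto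
      then have "card (R q) < card (R (q + B + W))"
        using R_I fin by (meson finite_subset psubset_card_mono)
      then show ?thesis using Suc False unfolding q2 by (simp add: q_def)
    qed
  qed simp
  then have "R (p + card I * (B + W)) = I"
    using R_I fin by (meson card_seteq)
  then have "i \<in> R q" using R_mono[of "p + card I * (B + W)" q] q i by auto
  then show ?thesis by (simp add: R_def)
qed

section \<open>Contraction of the balls and the exponential rate\<close>

lemma contraction:
  obtains \<rho> L where "0 < \<rho>" "\<rho> < 1" "0 < L"
    and "\<And>v r a. \<lbrakk>v \<in> K; 0 \<le> r; p0 \<le> a; near v r a\<rbrakk> \<Longrightarrow> \<exists>v'\<in>K. near v' (\<rho> * r) (a + L)"
proof -
  obtain \<kappa> where \<kappa>: "\<kappa> \<ge> 0"
    and reg: "\<And>f \<eta>. \<lbrakk>\<eta> \<ge> 0; \<And>i. i \<in> I \<Longrightarrow> \<exists>g\<in>S i. norm (f - g) \<le> \<eta>\<rbrakk>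
      \<Longrightarrow> \<exists>v\<in>K. norm (f - v) \<le> \<kappa> * \<eta>"
    using subspaces_linearly_regular[OF fin, of S] subsp by metis
  \<comment> \<open>\<open>H\<close> bounds \<open>p - q\<close> for all \<open>q \<ge> a\<close>
    and \<open>p \<le> F + B\<close>, with \<open>F\<close> as below. \<open>\<eta>\<close> is
    chosen so that \<open>\<eta> + \<kappa> * \<eta> = 1/2\<close>, and \<open>\<epsilon>\<close> so
    that a deficit below \<open>\<epsilon> * r\<^sup>2\<close> forces distances of at most
    \<open>\<eta> * r\<close> after up to \<open>H\<close> averaging steps.\<close>
  define H where "H = 3 * B + card I * (B + W)"
  define \<eta> where "\<eta> = 1 / (2 * (1 + \<kappa>))"
  define \<epsilon> where "\<epsilon> = weight ^ H * \<eta>\<^sup>2"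
  define \<rho> where "\<rho> = max (1/2) (sqrt (1 - \<epsilon>))"
  have \<eta>: "0 < \<eta>" "\<eta> \<le> 1/2" "\<eta> + \<kappa> * \<eta> = 1/2" using \<kappa> by (auto simp: \<eta>_def field_simps)
  have wH: "0 < weight ^ H" "weight ^ H \<le> 1" using weight by (auto intro: power_le_one)
  have "\<eta>\<^sup>2 \<le> (1/2)\<^sup>2" using \<eta> by (intro power_mono) auto
  then have "\<epsilon> \<le> 1 * (1/2)\<^sup>2" unfolding \<epsilon>_def using wH by (intro mult_mono) auto
  then have \<epsilon>: "0 < \<epsilon>" "\<epsilon> < 1" using wH \<eta> by (auto simp: \<epsilon>_def power2_eq_square)
  show thesis
  proof (rule that[of \<rho> "2 * B + card I * (B + W)"])
    show "0 < \<rho>" "\<rho> < 1" using \<epsilon> by (auto simp: \<rho>_def)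
    show "0 < 2 * B + card I * (B + W)" using B_pos by simp
    fix v r a assume v: "v \<in> K" and r: "(0::real) \<le> r" and a: "p0 \<le> a" and near: "near v r a"
    \<comment> \<open>By time \<open>F\<close> the traces of all states in the window from
      \<open>a + B\<close> to \<open>a + 2 * B\<close> have reached every agent. That window and the
      one from \<open>F\<close> to \<open>F + B\<close> have the length \<open>nearI\<close> asks
      for.\<close>
    define F where "F = a + (2 * B + card I * (B + W))"
    show "\<exists>v'\<in>K. near v' (\<rho> * r) F"
    proof (cases "\<forall>i\<in>I. \<forall>p. F \<le> p \<and> p \<le> F + B \<longrightarrow> (norm (u i p - v))\<^sup>2 \<le> (1 - \<epsilon>) * r\<^sup>2")
      case True
      have "near v (\<rho> * r) F"
      proof (rule nearI[OF v])
        show "p0 \<le> F" "0 \<le> \<rho> * r" using a r by (auto simp: F_def \<rho>_def)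
        fix i p assume "i \<in> I" "F \<le> p" "p \<le> F + B"
        then have "(norm (u i p - v))\<^sup>2 \<le> (1 - \<epsilon>) * r\<^sup>2" using True by blast
        then have "norm (u i p - v) \<le> sqrt ((1 - \<epsilon>) * r\<^sup>2)" by (rule real_le_rsqrt)
        also have "\<dots> = sqrt (1 - \<epsilon>) * r" using r by (simp add: real_sqrt_mult)
        also have "\<dots> \<le> \<rho> * r" using r by (intro mult_right_mono) (auto simp: \<rho>_def)
        finally show "norm (u i p - v) \<le> \<rho> * r" .
      qed
      then show ?thesis using v by blast
    next
      case False
      then obtain i p where i: "i \<in> I" and p: "F \<le> p" "p \<le> F + B"
        and f: "(1 - \<epsilon>) * r\<^sup>2 < (norm (u i p - v))\<^sup>2" by force
      have close: "norm (u j q - u i p) \<le> \<eta> * r" if j: "j \<in> I" and q: "a + B \<le> q" "q \<le> a + 2 * B" for j q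
      proof -
        have g: "norm (u j q - v) \<le> r" using near j q by (simp add: near_def)
        have "infl v r (p - q) (u j q) (u i p)"
          using infl_eventually_all[OF near v a j q(1) i] q p by (simp add: F_def)
        moreover have "p - q \<le> H" using p q by (simp add: F_def H_def)
        ultimately have "infl v r H (u j q) (u i p)" using infl_mono g by blast
        \<comment> \<open>The ball failed to shrink, so the deficit of \<open>u i p\<close> is below
          \<open>\<epsilon> * r\<^sup>2\<close>, while its trace inequality bounds the distance to
          \<open>u j q\<close> by that deficit.\<close>
        then have "weight ^ H * (r\<^sup>2 - (norm (u j q - v))\<^sup>2 + (norm (u j q - u i p))\<^sup>2) \<le> \<epsilon> * r\<^sup>2"
          using f by (simp add: infl_def algebra_simps)
        also have "\<dots> = weight ^ H * (\<eta> * r)\<^sup>2" by (simp add: \<epsilon>_def power_mult_distrib)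
        finally have "r\<^sup>2 - (norm (u j q - v))\<^sup>2 + (norm (u j q - u i p))\<^sup>2 \<le> (\<eta> * r)\<^sup>2"
          using wH by simp
        moreover have "(norm (u j q - v))\<^sup>2 \<le> r\<^sup>2" using g by (intro power_mono) auto
        ultimately have "(norm (u j q - u i p))\<^sup>2 \<le> (\<eta> * r)\<^sup>2" by linarith
        then show ?thesis using \<eta> r by (simp add: power2_le_iff_abs_le)
      qed
      have "\<exists>g\<in>S j. norm (u i p - g) \<le> \<eta> * r" if "j \<in> I" for j
        using close[OF that, of "a + B"] mem[OF that, of "a + B"]
        by (intro bexI[of _ "u j (a + B)"]) (simp_all add: norm_minus_commute)
      \<comment> \<open>\<open>u i p\<close> is close to a member of every \<open>S j\<close>, so
        linear regularity provides a new centre in \<open>K\<close>.\<close>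
      then obtain v' where v': "v' \<in> K" "norm (u i p - v') \<le> \<kappa> * (\<eta> * r)"
        using reg[of "\<eta> * r" "u i p"] \<eta> r by auto
      have "near v' (r / 2) (a + B)"
      proof (rule nearI[OF v'(1)])
        show "p0 \<le> a + B" "0 \<le> r / 2" using a r by auto
        fix j q assume "j \<in> I" "a + B \<le> q" "q \<le> a + B + B"
        then have "norm (u j q - u i p) \<le> \<eta> * r" using close by simp
        then have "norm (u j q - v') \<le> \<eta> * r + \<kappa> * (\<eta> * r)"
          using v'(2) norm_triangle_ineq[of "u j q - u i p" "u i p - v'"] by simp
        also have "\<dots> = (\<eta> + \<kappa> * \<eta>) * r" by (simp add: algebra_simps)
        finally show "norm (u j q - v') \<le> r / 2" using \<eta>(3) by simp
      qed
      moreover have "r / 2 \<le> \<rho> * r" using mult_right_mono[of "1/2" \<rho> r] r by (simp add: \<rho>_def)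
      ultimately have "near v' (\<rho> * r) F"
        unfolding near_def F_def by (metis add.commute add_leE le_add1 mult_2 order_trans group_cancel.add1)
      then show ?thesis using v'(1) by blast
    qed
  qed
qed

text \<open>Iterating \<open>contraction\<close> gives centres in \<open>K\<close> with
  geometrically shrinking balls that contain all later states. The centres form a Cauchy sequence,
  and their limit stays in the closed set \<open>K\<close>.\<close>

theorem exponential_consensus:
  obtains q z C where "0 < q" "q < 1" "z \<in> K" "\<And>i p. i \<in> I \<Longrightarrow> norm (u i p - z) \<le> C * q ^ p"
proof -
  obtain \<rho> L where \<rho>: "0 < \<rho>" "\<rho> < 1" and L: "0 < L"
    and contr: "\<And>v r a. \<lbrakk>v \<in> K; 0 \<le> r; p0 \<le> a; near v r a\<rbrakk> \<Longrightarrow> \<exists>v'\<in>K. near v' (\<rho> * r) (a + L)"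
    using contraction by metis
  \<comment> \<open>A crude radius around 0 that covers the initial window required by
    \<open>nearI\<close>.\<close>
  define r where "r = (\<Sum>(i, p)\<in>I \<times> {..p0 + B}. norm (u i p))"
  have r: "norm (u i p) \<le> r" if "i \<in> I" "p \<le> p0 + B" for i p
    unfolding r_def using member_le_sum[of "(i, p)" "I \<times> {..p0 + B}" "\<lambda>(i, p). norm (u i p)"] that fin
    by auto
  have r0: "0 \<le> r" unfolding r_def by (intro sum_nonneg) auto
  have zero: "0 \<in> K" using subsp by (auto simp: subspace_0)
  have near0: "near 0 r p0" using nearI[OF zero order_refl r0] r by simp
  have "\<exists>v\<in>K. near v (\<rho> ^ k * r) (p0 + k * L)" for k
  proof (induction k)
    case 0
    show ?case using zero near0 by auto
  next
    case (Suc k)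
    then obtain v where "v \<in> K" "near v (\<rho> ^ k * r) (p0 + k * L)" by blast
    then show ?case using contr[of v "\<rho> ^ k * r" "p0 + k * L"] \<rho> r0 by (auto simp: algebra_simps)
  qed
  then obtain v where v: "\<And>k. v k \<in> K" "\<And>k. near (v k) (\<rho> ^ k * r) (p0 + k * L)" by metis
  obtain i0 where i0: "i0 \<in> I" using ne by blast
  have v_dist: "dist (v k') (v k) \<le> 2 * r * \<rho> ^ k" if "k \<le> k'" for k k'
  proof -
    \<comment> \<open>A state late enough to lie in both balls, hence linking their centres.\<close>
    let ?x = "u i0 (p0 + k' * L)"
    have "norm (?x - v k') \<le> \<rho> ^ k' * r" "norm (?x - v k) \<le> \<rho> ^ k * r"
      using v(2) i0 that by (auto simp: near_def)
    moreover have "\<rho> ^ k' * r \<le> \<rho> ^ k * r"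
      using \<rho> r0 that by (intro mult_right_mono power_decreasing) auto
    ultimately have "dist (v k') (v k) \<le> \<rho> ^ k * r + \<rho> ^ k * r"
      using dist_triangle3[of "v k'" "v k" ?x] unfolding dist_norm by linarith
    then show ?thesis by (simp add: algebra_simps)
  qed
  have \<rho>0: "(\<lambda>k. 2 * r * \<rho> ^ k) \<longlonglongrightarrow> 0"
    using \<rho> by (intro tendsto_mult_right_zero LIMSEQ_power_zero) auto
  have "Cauchy v"
  proof (rule metric_CauchyI)
    fix e :: real assume "0 < e"
    then have "\<forall>\<^sub>F k in sequentially. 2 * r * \<rho> ^ k < e" by (rule order_tendstoD(2)[OF \<rho>0])
    then obtain M where "2 * r * \<rho> ^ k < e" if "M \<le> k" for k by (auto simp: eventually_sequentially)
    then have "dist (v m) (v n) < e" if "M \<le> m" "M \<le> n" for m n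
      using that v_dist[of m n] v_dist[of n m] by (cases m n rule: linorder_cases) (force simp: dist_commute)+
    then show "\<exists>M. \<forall>m\<ge>M. \<forall>n\<ge>M. dist (v m) (v n) < e" by blast
  qed
  then obtain z where z: "v \<longlonglongrightarrow> z" using convergent_eq_Cauchy by blast
  have "closed K" using subsp by (intro closed_INT) (auto intro: closed_subspace)
  then have zK: "z \<in> K" using closed_sequentially v(1) z by blast
  have vz: "norm (v k - z) \<le> 2 * r * \<rho> ^ k" for k
  proof (rule LIMSEQ_le_const2)
    show "(\<lambda>k'. norm (v k - v k')) \<longlonglongrightarrow> norm (v k - z)" using z by (intro tendsto_intros)
    show "\<exists>N. \<forall>k'\<ge>N. norm (v k - v k') \<le> 2 * r * \<rho> ^ k"
      using v_dist by (metis dist_commute dist_norm)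
  qed
  have late: "norm (u i p - z) \<le> 3 * r * \<rho> ^ k" if "i \<in> I" "p0 + k * L \<le> p" for i p k
  proof -
    have "norm (u i p - v k) \<le> \<rho> ^ k * r" using v(2) that by (simp add: near_def)
    then show ?thesis using vz[of k] norm_triangle_ineq[of "u i p - v k" "v k - z"] by (simp add: algebra_simps)
  qed
  \<comment> \<open>One factor \<open>\<rho>\<close> is gained every \<open>L\<close> indices. In
    \<open>C1\<close>, the power \<open>q ^ L\<close> makes up for the remainder on division by
    \<open>L\<close>; \<open>C2\<close> takes care of the indices up to \<open>p0\<close>.\<close>
  define q where "q = root L \<rho>"
  have q: "0 < q" "q < 1" and q_power: "q ^ L = \<rho>" using \<rho> L by (auto simp: q_def)
  define C1 where "C1 = 3 * r / q ^ (p0 + L)"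
  define C2 where "C2 = (r + norm z) / q ^ p0"
  have C: "0 \<le> C1" "0 \<le> C2" using r0 q by (auto simp: C1_def C2_def)
  show thesis
  proof (rule that[of q z "C1 + C2"])
    show "0 < q" "q < 1" "z \<in> K" using q zK by auto
    fix i p assume i: "i \<in> I"
    show "norm (u i p - z) \<le> (C1 + C2) * q ^ p"
    proof (cases "p \<le> p0")
      case True
      have "norm (u i p - z) \<le> r + norm z"
        using r[OF i, of p] True norm_triangle_ineq4[of "u i p" z] by simp
      also have "\<dots> = C2 * q ^ p0" using q by (simp add: C2_def)
      also have "\<dots> \<le> C2 * q ^ p" using True q C by (intro mult_left_mono power_decreasing) auto
      also have "\<dots> \<le> (C1 + C2) * q ^ p" using C q by (intro mult_right_mono) auto
      finally show ?thesis .
    next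
      case False
      define k where "k = (p - p0) div L"
      have k: "p0 + k * L \<le> p" "p < p0 + k * L + L"
        using False L div_mult_mod_eq[of "p - p0" L] mod_less_divisor[OF L, of "p - p0"]
        unfolding k_def by linarith+
      have "norm (u i p - z) \<le> 3 * r * \<rho> ^ k" by (rule late[OF i k(1)])
      also have "\<rho> ^ k = q ^ (k * L)" using q_power by (metis mult.commute power_mult)
      also have "3 * r * q ^ (k * L) = C1 * q ^ (p0 + k * L + L)"
        using q(1) by (simp add: C1_def power_add)
      also have "\<dots> \<le> C1 * q ^ p" using k q C by (intro mult_left_mono power_decreasing) auto
      also have "\<dots> \<le> (C1 + C2) * q ^ p" using C q by (intro mult_right_mono) auto
      finally show ?thesis .
    qed
  qed
qed

end

subsection \<open>Joint strong connectivity\<close>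

text \<open>Used in contrapositive form: an arc of the composition is a path through the successive
  factors, so if it leaves \<open>J\<close>, then an arc of some factor does.\<close>

lemma parcs_joint_graph_closed:
  assumes closed: "\<And>p i j. a \<le> p \<Longrightarrow> p \<le> a + d \<Longrightarrow> (j, i) \<in> parcs (G p) \<Longrightarrow> j \<in> J \<Longrightarrow> i \<in> J"
    and "(j, i) \<in> parcs (joint_graph G a d)" "j \<in> J"
  shows "i \<in> J"
  using assms
proof (induction d arbitrary: i)
  case 0
  then show ?case by simp
next
  case (Suc d)
  then obtain h where h: "(j, h) \<in> parcs (joint_graph G a d)" "(h, i) \<in> parcs (G (a + Suc d))"
    by (auto simp: graph_comp_def)
  have "h \<in> J"
  proof (rule Suc.IH[OF _ h(1) Suc.prems(3)])
    fix p i j assume "a \<le> p" "p \<le> a + d" "(j, i) \<in> parcs (G p)" "j \<in> J"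
    then show "i \<in> J" using Suc.prems(1)[of p j i] by simp
  qed
  then show ?case using Suc.prems(1)[of "a + Suc d" h i] h(2) by simp
qed

lemma pverts_joint_graph: "pverts (joint_graph G a d) = pverts (G a)"
  by (induction d) (simp_all add: graph_comp_def)

lemma strongly_connected_leaving_arc:
  assumes sc: "strongly_connected G" and J: "J \<subseteq> verts G" "J \<noteq> {}" "J \<noteq> verts G"
  obtains j i where "(j, i) \<in> arcs_ends G" "j \<in> J" "i \<notin> J"
proof (rule ccontr)
  assume no: "\<not> thesis"
  obtain a b where ab: "a \<in> J" "b \<in> verts G" "b \<notin> J" using J by blast
  then have "(a, b) \<in> rtrancl_on (verts G) (arcs_ends G)"
    using sc J unfolding strongly_connected_def reachable_def by blast
  then have "b \<in> J"
    by (induction rule: rtrancl_on_induct) (use ab no that in auto)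
  then show False using ab by simp
qed

text \<open>A window of length \<open>2 * l\<close> contains a complete block of \<open>l\<close>
  graphs, wherever it begins. The composition of that block has an arc leaving \<open>J\<close>,
  hence so has one of its graphs.\<close>

lemma repeatedly_jointly_strongly_connected_window:
  assumes rj: "repeatedly_jointly_strongly_connected G" and V: "\<And>p. pverts (G p) = V"
  obtains W \<tau> where "\<And>a J. \<lbrakk>\<tau> \<le> a; J \<subseteq> V; J \<noteq> {}; J \<noteq> V\<rbrakk> \<Longrightarrow>
      \<exists>p j i. a < p \<and> p \<le> a + W \<and> (j, i) \<in> parcs (G p) \<and> j \<in> J \<and> i \<notin> J"
proof -
  obtain l \<tau> where l: "1 \<le> l"
    and sc: "\<And>k. 1 \<le> k \<Longrightarrow> strongly_connected (with_proj (joint_graph G ((k - 1) * l + \<tau>) (l - 1)))"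
    using rj unfolding repeatedly_jointly_strongly_connected_def by blast
  show thesis
  proof (rule that[of \<tau> "2 * l"])
    fix a J assume a: "\<tau> \<le> a" and J: "J \<subseteq> V" "J \<noteq> {}" "J \<noteq> V"
    \<comment> \<open>Start of the first block that begins strictly after \<open>a\<close>.\<close>
    define b where "b = ((a - \<tau>) div l + 1) * l + \<tau>"
    have b: "a < b" "b \<le> a + l"
      using a l div_mult_mod_eq[of "a - \<tau>" l] mod_less_divisor[of l "a - \<tau>"]
      unfolding b_def add_mult_distrib by linarith+
    have "strongly_connected (with_proj (joint_graph G b (l - 1)))"
      using sc[of "(a - \<tau>) div l + 1 + 1"] by (simp add: b_def)
    then obtain j i where ji: "(j, i) \<in> parcs (joint_graph G b (l - 1))" "j \<in> J" "i \<notin> J"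
      using strongly_connected_leaving_arc[of "with_proj (joint_graph G b (l - 1))" J] J
      by (auto simp: pverts_joint_graph V)
    have "\<exists>p j i. b \<le> p \<and> p \<le> b + (l - 1) \<and> (j, i) \<in> parcs (G p) \<and> j \<in> J \<and> i \<notin> J"
      using parcs_joint_graph_closed[OF _ ji(1,2)] ji(3) by blast
    then obtain p j i where "b \<le> p" "p \<le> b + (l - 1)" "(j, i) \<in> parcs (G p)" "j \<in> J" "i \<notin> J"
      by blast
    moreover from this have "a < p" "p \<le> a + 2 * l" using b l by linarith+
    ultimately show "\<exists>p j i. a < p \<and> p \<le> a + 2 * l \<and> (j, i) \<in> parcs (G p) \<and> j \<in> J \<and> i \<notin> J"
      by blast
  qed
qed

subsection \<open>Row lists\<close>

lemma kernel_rows_iff: "v \<in> kernel_rows M \<longleftrightarrow> (\<forall>r\<in>set M. r \<bullet> v = 0)"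
  by (auto simp: kernel_rows_def mult_rows_def list_eq_iff_nth_eq all_set_conv_all_nth)

lemma subspace_kernel_rows: "subspace (kernel_rows M)"
  by (auto simp: subspace_def kernel_rows_iff inner_simps)

lemma diff_mem_kernel_rows_iff: "v - w \<in> kernel_rows M \<longleftrightarrow> mult_rows M v = mult_rows M w"
  by (auto simp: kernel_rows_iff mult_rows_def inner_simps)

text \<open>Equal block lengths let the concatenations be compared block by block.\<close>

lemma mult_rows_stack_eq_iff:
  assumes "\<And>i. i \<in> {1..m} \<Longrightarrow> length (M i) = length (b i)"
  shows "mult_rows (stack m M) z = stack m b \<longleftrightarrow> (\<forall>i\<in>{1..m}. mult_rows (M i) z = b i)"
proof -
  have "mult_rows (stack m M) z = concat (map (\<lambda>i. mult_rows (M i) z) [1..<Suc m])"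
    by (simp add: stack_def mult_rows_def map_concat comp_def del: upt_Suc)
  moreover have "concat (map (\<lambda>i. mult_rows (M i) z) [1..<Suc m]) = concat (map b [1..<Suc m])
      \<longleftrightarrow> map (\<lambda>i. mult_rows (M i) z) [1..<Suc m] = map b [1..<Suc m]"
    by (rule concat_eq_concat_iff)
      (auto simp: zip_map1 zip_map2 zip_same_conv_map mult_rows_def assms simp del: upt_Suc)
  ultimately show ?thesis
    by (auto simp: stack_def simp del: upt_Suc)
qed

lemma converges_as_fast_as_tendsto:
  assumes "converges_as_fast_as y z q" "0 < q" "q < 1"
  shows "y \<longlonglongrightarrow> z"
proof -
  obtain c where c: "\<And>p. 1 \<le> p \<Longrightarrow> norm (y p - z) \<le> c * q ^ p"
    using assms(1) by (auto simp: converges_as_fast_as_def)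
  have "(\<lambda>p. c * q ^ p) \<longlonglongrightarrow> 0"
    using assms by (intro tendsto_mult_right_zero LIMSEQ_power_zero) auto
  then have "(\<lambda>p. y p - z) \<longlonglongrightarrow> 0"
    by (rule Lim_null_comparison[rotated]) (use c in \<open>auto simp: eventually_sequentially\<close>)
  then show ?thesis by (simp add: LIM_zero_iff)
qed

subsection \<open>The common time scale\<close>

locale common_time_scale =
  fixes m :: nat and ev :: "nat \<Rightarrow> nat \<Rightarrow> real" and T_min T_max :: "nat \<Rightarrow> real" and t :: "nat \<Rightarrow> real"
  assumes m: "0 < m"
    and T_min: "\<And>i. i \<in> {1..m} \<Longrightarrow> 0 < T_min i"
    and gaps: "\<And>i k. i \<in> {1..m} \<Longrightarrow> 1 \<le> k \<Longrightarrow>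
        T_min i \<le> ev i (k + 1) - ev i k \<and> ev i (k + 1) - ev i k \<le> T_max i"
    and labeling: "increasing_labeling t (common_times m ev)"
begin

lemma t_less: "1 \<le> p \<Longrightarrow> p < q \<Longrightarrow> t p < t q"
  using labeling by (auto simp: increasing_labeling_def strict_mono_on_def)

lemma t_le: "1 \<le> p \<Longrightarrow> p \<le> q \<Longrightarrow> t p \<le> t q"
  using t_less by (metis less_imp_le order_le_less)

lemma common_times_iff: "s \<in> common_times m ev \<longleftrightarrow> (\<exists>p\<ge>1. s = t p)"
  using labeling by (auto simp: increasing_labeling_def)

lemma ev_1_le: "i \<in> {1..m} \<Longrightarrow> 1 \<le> p \<Longrightarrow> ev i 1 \<le> t p"
proof -
  assume i: "i \<in> {1..m}" and p: "1 \<le> p"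
  have "(MAX i\<in>{1..m}. ev i 1) \<le> t p"
    using common_times_iff p unfolding common_times_def by blast
  moreover have "ev i 1 \<le> (MAX i\<in>{1..m}. ev i 1)" using i by (intro Max_ge) auto
  ultimately show ?thesis by simp
qed

lemma t_1: "t 1 = (MAX i\<in>{1..m}. ev i 1)"
proof -
  let ?M = "MAX i\<in>{1..m}. ev i 1"
  have "?M \<in> (\<lambda>i. ev i 1) ` {1..m}" using m by (intro Max_in) auto
  then have "?M \<in> common_times m ev" unfolding common_times_def event_times_def by fastforce
  then obtain q where "q \<ge> 1" "?M = t q" using common_times_iff by blast
  then have "t 1 \<le> ?M" using t_le by simp
  moreover have "?M \<le> t 1" using common_times_iff[of "t 1"] unfolding common_times_def by blast
  ultimately show ?thesis by simp
qed

lemma ev_labeled: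
  assumes "i \<in> {1..m}" "1 \<le> k" "t 1 \<le> ev i k"
  obtains q where "1 \<le> q" "ev i k = t q"
proof -
  have "ev i k \<in> common_times m ev"
    using assms unfolding common_times_def event_times_def t_1 by blast
  then show thesis using that common_times_iff by blast
qed

lemma ev_growth:
  assumes "i \<in> {1..m}" "1 \<le> k"
  shows "ev i k + n * T_min i \<le> ev i (k + n)"
proof (induction n)
  case (Suc n)
  then show ?case using gaps[of i "k + n"] assms by (simp add: algebra_simps)
qed simp

lemma ev_less: "i \<in> {1..m} \<Longrightarrow> 1 \<le> k \<Longrightarrow> k < l \<Longrightarrow> ev i k + T_min i \<le> ev i l"
proof -
  assume i: "i \<in> {1..m}" "1 \<le> k" and kl: "k < l"
  have "T_min i * 1 \<le> T_min i * real (l - k)" using T_min[OF i(1)] kl by (intro mult_left_mono) auto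
  then show ?thesis using ev_growth[OF i, of "l - k"] kl by (simp add: mult.commute)
qed

text \<open>For \<open>p \<ge> 1\<close> this is the number of the latest event of agent
  \<open>i\<close> up to \<open>t p\<close>, found through the first later event.\<close>

definition idx :: "nat \<Rightarrow> nat \<Rightarrow> nat" where
  "idx i p = (LEAST k. 1 \<le> k \<and> t p < ev i (k + 1))"

lemma
  assumes i: "i \<in> {1..m}"
  shows idx_ge: "1 \<le> idx i p" and idx_less: "t p < ev i (idx i p + 1)"
    and idx_le: "1 \<le> p \<Longrightarrow> ev i (idx i p) \<le> t p"
proof -
  \<comment> \<open>Gaps of at least \<open>T_min i\<close> make the event times unbounded, so the
    \<open>LEAST\<close> exists.\<close>
  obtain n where "t p - ev i 1 < real n * T_min i" using T_min[OF i] reals_Archimedean3 by blast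
  then have "t p < ev i (n + 1)" using ev_growth[OF i, of 1 n] by (simp add: add.commute)
  also have "\<dots> \<le> ev i (n + 1 + 1)" using ev_less[OF i, of "n + 1" "n + 1 + 1"] T_min[OF i] by simp
  finally have "1 \<le> n + 1 \<and> t p < ev i (n + 1 + 1)" by simp
  then have *: "1 \<le> idx i p \<and> t p < ev i (idx i p + 1)" unfolding idx_def by (rule LeastI)
  then show "1 \<le> idx i p" "t p < ev i (idx i p + 1)" by auto
  show "ev i (idx i p) \<le> t p" if p: "1 \<le> p"
  proof (cases "idx i p = 1")
    case True
    then show ?thesis using ev_1_le[OF i p] by simp
  next
    case False
    then have "\<not> t p < ev i (idx i p - 1 + 1)"
      using not_less_Least[of "idx i p - 1" "\<lambda>k. 1 \<le> k \<and> t p < ev i (k + 1)"] *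
      unfolding idx_def by linarith
    then show ?thesis using * by simp
  qed
qed

lemma idx_eqI:
  assumes i: "i \<in> {1..m}" and p: "1 \<le> p" and k: "1 \<le> k" "ev i k \<le> t p" "t p < ev i (k + 1)"
  shows "idx i p = k"
proof (rule antisym; rule ccontr)
  assume "\<not> idx i p \<le> k"
  then have "ev i (k + 1) \<le> ev i (idx i p)"
    using ev_less[OF i, of "k + 1" "idx i p"] T_min[OF i] by (cases "idx i p = k + 1") auto
  then show False using idx_le[OF i p] k by simp
next
  assume "\<not> k \<le> idx i p"
  then have "ev i (idx i p + 1) \<le> ev i k"
    using ev_less[OF i, of "idx i p + 1" k] T_min[OF i] by (cases "k = idx i p + 1") auto
  then show False using idx_less[OF i, of p] k by simp
qed

text \<open>Otherwise the event would itself be a common time, with a label strictly between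
  \<open>p - 1\<close> and \<open>p\<close>.\<close>

lemma ev_less_tD:
  assumes i: "i \<in> {1..m}" and p: "2 \<le> p" and k: "1 \<le> k" "ev i k < t p"
  shows "ev i k \<le> t (p - 1)"
proof (rule ccontr)
  assume neg: "\<not> ?thesis"
  have p': "1 \<le> p - 1" using p by simp
  then have "t 1 \<le> ev i k" using t_le[of 1 "p - 1"] neg by simp
  then obtain q where q: "1 \<le> q" "ev i k = t q" using ev_labeled i k by metis
  have "\<not> q \<le> p - 1" using t_le[of q "p - 1"] q neg by auto
  moreover have "\<not> p \<le> q" using t_le[of p q] q k p by auto
  ultimately show False by simp
qed

lemma idx_event:
  assumes i: "i \<in> {1..m}" and p: "2 \<le> p" and event: "t p \<in> event_times ev i"
  shows "t p = ev i (idx i p)" "idx i p = idx i (p - 1) + 1"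
proof -
  have p': "1 \<le> p - 1" "p - 1 < p" using p by auto
  obtain k where k: "1 \<le> k" "t p = ev i k" using event by (auto simp: event_times_def)
  have inc: "ev i j < ev i (j + 1)" if "1 \<le> j" for j using ev_less[OF i that] T_min[OF i] by force
  have "idx i p = k" using idx_eqI[OF i _ k(1)] k inc p by simp
  moreover
  \<comment> \<open>All first events are at or before \<open>t 1\<close>, and
    \<open>p \<ge> 2\<close>.\<close>
  have "k \<noteq> 1" using ev_1_le[OF i p'(1)] t_less[OF p'] k by auto
  then have k2: "1 \<le> k - 1" "k - 1 + 1 = k" using k by auto
  then have "ev i (k - 1) \<le> t (p - 1)" using ev_less_tD[OF i p k2(1)] inc[OF k2(1)] k by simp
  then have "idx i (p - 1) = k - 1"
    using idx_eqI[OF i p'(1) k2(1)] k2 k t_less[OF p'] by simp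
  ultimately show "t p = ev i (idx i p)" "idx i p = idx i (p - 1) + 1" using k k2 by auto
qed

lemma idx_no_event:
  assumes i: "i \<in> {1..m}" and p: "2 \<le> p" and no_event: "t p \<notin> event_times ev i"
  shows "idx i p = idx i (p - 1)"
proof -
  have p': "1 \<le> p - 1" "p - 1 < p" using p by auto
  have "ev i (idx i p) \<noteq> t p" using no_event idx_ge[OF i, of p] by (force simp: event_times_def)
  then have "ev i (idx i p) \<le> t (p - 1)"
    using ev_less_tD[OF i p idx_ge[OF i, of p]] idx_le[OF i, of p] p by simp
  moreover have "t (p - 1) < ev i (idx i p + 1)"
    using idx_less[OF i, of p] t_less[OF p'] by simp
  ultimately show ?thesis using idx_eqI[OF i p'(1) idx_ge[OF i]] by simp
qed

text \<open>Among \<open>m + 1\<close> consecutive common times two belong to the same agent.\<close>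

lemma t_spread:
  assumes p: "1 \<le> p"
  shows "t p + Min (T_min ` {1..m}) \<le> t (p + m)"
proof -
  have "\<exists>i\<in>{1..m}. \<exists>k\<ge>1. t q = ev i k" if q: "1 \<le> q" for q
  proof -
    have "t q \<in> common_times m ev" using q common_times_iff by blast
    then show ?thesis unfolding common_times_def event_times_def by blast
  qed
  then obtain a k where ak: "\<And>q. 1 \<le> q \<Longrightarrow> a q \<in> {1..m} \<and> 1 \<le> k q \<and> t q = ev (a q) (k q)"
    by metis
  have "a ` {p..p + m} \<subseteq> {1..m}" using ak p by force
  then have "card (a ` {p..p + m}) \<le> m" using card_mono[of "{1..m}"] by fastforce
  then have "\<not> inj_on a {p..p + m}" by (intro pigeonhole) simp
  then obtain q r where qr: "p \<le> q" "q < r" "r \<le> p + m" "a q = a r"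
    by (auto simp: inj_on_def) (metis atLeastAtMost_iff nat_neq_iff)
  have aq: "a q \<in> {1..m}" "1 \<le> k q" "1 \<le> k r" "t q = ev (a q) (k q)" "t r = ev (a q) (k r)"
    using ak[of q] ak[of r] qr p by auto
  have lt: "t q < t r" using t_less qr p by simp
  have "k q < k r"
  proof (rule ccontr)
    assume "\<not> k q < k r"
    then have "ev (a q) (k r) \<le> ev (a q) (k q)"
      using ev_less[OF aq(1,3), of "k q"] T_min[OF aq(1)] by (cases "k q = k r") auto
    then show False using lt aq by simp
  qed
  then have "t q + T_min (a q) \<le> t r" using ev_less aq by simp
  moreover have "Min (T_min ` {1..m}) \<le> T_min (a q)" using aq by simp
  moreover have "t p \<le> t q" "t r \<le> t (p + m)" using t_le qr p by auto
  ultimately show ?thesis by linarith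
qed

text \<open>The latest event lies less than \<open>M\<close> before \<open>t p\<close>, whereas by
  \<open>t_spread\<close> any \<open>n * m\<close> steps of the common scale take at least
  \<open>n * T > M\<close>. So the label \<open>q\<close> of that event exceeds
  \<open>p - n * m \<ge> 1\<close>.\<close>

lemma last_event_bounded:
  obtains B where "\<And>i p. i \<in> {1..m} \<Longrightarrow> B < p \<Longrightarrow>
      \<exists>q. 2 \<le> q \<and> q \<le> p \<and> p < q + B \<and> t q = ev i (idx i p)"
proof -
  define T where "T = Min (T_min ` {1..m})"
  define M where "M = Max (T_max ` {1..m})"
  have T: "0 < T" using T_min m by (simp add: T_def)
  then obtain n where n: "M < real n * T" using reals_Archimedean3 by blast
  have growth: "t p + real n * T \<le> t (p + n * m)" if "1 \<le> p" for p n
  proof (induction n)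
    case (Suc n)
    then show ?case using t_spread[of "p + n * m"] that by (simp add: T_def algebra_simps)
  qed simp
  show thesis
  proof (rule that[of "n * m"])
    fix i p assume i: "i \<in> {1..m}" and p: "n * m < p"
    let ?k = "idx i p"
    have "T_max i \<le> M" unfolding M_def using i by (intro Max_ge) auto
    then have "t p < ev i ?k + M"
      using idx_less[OF i, of p] gaps[OF i idx_ge[OF i, of p]] by linarith
    moreover have "t (p - n * m) + real n * T \<le> t p"
      using growth[of "p - n * m" n] p by (simp only: le_add_diff_inverse2 less_imp_le)
    ultimately have lt: "t (p - n * m) < ev i ?k" using n by linarith
    moreover have "t 1 \<le> t (p - n * m)" using p by (intro t_le) auto
    ultimately have "t 1 \<le> ev i ?k" by linarith
    with i idx_ge[OF i] obtain q where q: "1 \<le> q" "ev i ?k = t q" by (rule ev_labeled)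
    have "\<not> q \<le> p - n * m" using t_le[of q "p - n * m"] q lt by auto
    moreover have "\<not> p < q" using t_less[of p q] idx_le[OF i, of p] q p by auto
    ultimately show "\<exists>q. 2 \<le> q \<and> q \<le> p \<and> p < q + n * m \<and> t q = ev i ?k"
      using q p by (intro exI[of _ q]) auto
  qed
qed

end

subsection \<open>The asynchronous algorithm\<close>

theorem theorem4:
  fixes m :: nat
    and d :: "nat \<Rightarrow> nat"
    and A :: "nat \<Rightarrow> (real^'n) list"
    and b :: "nat \<Rightarrow> real list"
    and P :: "nat \<Rightarrow> real^'n^'n"
    and ev :: "nat \<Rightarrow> nat \<Rightarrow> real"
    and T_min T_max :: "nat \<Rightarrow> real"
    and N :: "nat \<Rightarrow> real \<Rightarrow> nat set"
    and x :: "nat \<Rightarrow> real \<Rightarrow> real^'n"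
    and t :: "nat \<Rightarrow> real"
  assumes "m > 1"
    and dims: "\<And>i. i \<in> {1..m} \<Longrightarrow> length (A i) = d i \<and> length (b i) = d i"
    and solvable: "\<exists>z. mult_rows (stack m A) z = stack m b"
    and proj: "\<And>i. i \<in> {1..m} \<Longrightarrow> orthogonal_projection_matrix (P i) (kernel_rows (A i))"
    and ev_nonneg: "\<And>i k. i \<in> {1..m} \<Longrightarrow> 1 \<le> k \<Longrightarrow> 0 \<le> ev i k"
    and ev_mono: "\<And>i. i \<in> {1..m} \<Longrightarrow> strict_mono_on {1..} (ev i)"
    and T_bounds: "\<And>i. i \<in> {1..m} \<Longrightarrow> 0 < T_min i \<and> T_min i < T_max i"
    and ev_gaps: "\<And>i k. i \<in> {1..m} \<Longrightarrow> 1 \<le> k \<Longrightarrow>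
        T_min i \<le> ev i (k + 1) - ev i k \<and> ev i (k + 1) - ev i k \<le> T_max i"
    and nbrs_init: "\<And>i. i \<in> {1..m} \<Longrightarrow> N i (ev i 1) = {i}"
    and nbrs: "\<And>i k. i \<in> {1..m} \<Longrightarrow> 1 < k \<Longrightarrow> N i (ev i k) \<subseteq> {1..m} \<and> i \<in> N i (ev i k)"
    and nbrs_available: "\<And>i k j. i \<in> {1..m} \<Longrightarrow> 1 < k \<Longrightarrow> j \<in> N i (ev i k) \<Longrightarrow> ev j 1 \<le> ev i k"
    and state_const: "\<And>i k s. i \<in> {1..m} \<Longrightarrow> 1 \<le> k \<Longrightarrow> s \<in> {ev i k..<ev i (k + 1)} \<Longrightarrow>
        x i s = x i (ev i k)"
    and init: "\<And>i. i \<in> {1..m} \<Longrightarrow> mult_rows (A i) (x i (ev i 1)) = b i"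
    and update: "\<And>i k. i \<in> {1..m} \<Longrightarrow> 1 \<le> k \<Longrightarrow>
        x i (ev i (k + 1)) = x i (ev i k) -
          (1 / real (card (N i (ev i k)))) *\<^sub>R
            (P i *v (real (card (N i (ev i k))) *\<^sub>R x i (ev i k) - (\<Sum>j\<in>N i (ev i k). x j (ev i k))))"
    and time_scale: "increasing_labeling t (common_times m ev)"
    and connectivity: "repeatedly_jointly_strongly_connected (ext_nbr_graph m ev t N)"
  shows "\<exists>q. 0 < q \<and> q < 1 \<and>
      (\<exists>z. mult_rows (stack m A) z = stack m b \<and>
        (\<forall>i\<in>{1..m}. (\<lambda>p. x i (t p)) \<longlonglongrightarrow> z \<and> converges_as_fast_as (\<lambda>p. x i (t p)) z q))"
proof -
  let ?I = "{1..m}"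
  interpret common_time_scale m ev T_min T_max t
    using \<open>m > 1\<close> T_bounds ev_gaps time_scale by unfold_locales auto
  obtain z0 where z0: "mult_rows (stack m A) z0 = stack m b" using solvable by blast
  have stack_iff: "mult_rows (stack m A) z = stack m b \<longleftrightarrow> (\<forall>i\<in>?I. mult_rows (A i) z = b i)" for z
    using dims by (intro mult_rows_stack_eq_iff) auto
  \<comment> \<open>Relative to \<open>z0\<close>, the affine solution sets of the agents become
    these subspaces.\<close>
  define S where "S i = kernel_rows (A i)" for i
  have subsp: "subspace (S i)" for i by (simp add: S_def subspace_kernel_rows)
  have P_mem: "P i *v a \<in> S i" and P_orth: "\<And>y. y \<in> S i \<Longrightarrow> (a - P i *v a) \<bullet> y = 0"
    if "i \<in> ?I" for i a
    using proj[OF that] by (auto simp: orthogonal_projection_matrix_def orthogonal_def S_def)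
  have state_mem: "x i (ev i k) - z0 \<in> S i" if i: "i \<in> ?I" and k: "1 \<le> k" for i k
    using k
  proof (induction k rule: dec_induct)
    case base
    show ?case using init[OF i] z0 stack_iff i by (simp add: S_def diff_mem_kernel_rows_iff)
  next
    case (step k)
    have "x i (ev i (k + 1)) - x i (ev i k) \<in> S i"
      using update[OF i step(1)] subspace_neg[OF subsp subspace_scale[OF subsp P_mem[OF i]]] by simp
    from subspace_add[OF subsp this step.IH] show ?case by simp
  qed
  \<comment> \<open>The update at an event uses the neighbours at that event, but its result appears
    only at the next one. The \<open>+ 1\<close> indexes the result by the event that computes it,
    so that \<open>u i p\<close> belongs to the neighbours at \<open>t p\<close>.\<close>
  define u where "u i p = x i (ev i (idx i p + 1)) - z0" for i p
  have state_t: "x i (t p) = x i (ev i (idx i p))" if "i \<in> ?I" "1 \<le> p" for i p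
    using idx_le[OF that] idx_less[OF that(1), of p]
    by (intro state_const[OF that(1) idx_ge[OF that(1), of p]]) simp
  have u_event: "x i (t p) - z0 = u i (p - 1)"
    if "i \<in> ?I" "2 \<le> p" "t p \<in> event_times ev i" for i p
    using idx_event[OF that] by (simp add: u_def)
  obtain B where B: "\<And>i p. i \<in> ?I \<Longrightarrow> B < p \<Longrightarrow>
      \<exists>q. 2 \<le> q \<and> q \<le> p \<and> p < q + B \<and> t q = ev i (idx i p)"
    by (rule last_event_bounded) blast
  \<comment> \<open>The state at \<open>t p\<close> was adopted at the agent's latest event
    \<open>t q\<close>, hence equals \<open>u i (q - 1)\<close>; this is where the bounded delay
    comes from.\<close>
  have "\<exists>s. s < p \<and> p \<le> s + B \<and> x i (t p) - z0 = u i s" if i: "i \<in> ?I" and p: "B < p" for i p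
  proof -
    obtain q where q: "2 \<le> q" "q \<le> p" "p < q + B" "t q = ev i (idx i p)" using B[OF i p] by blast
    have "t q \<in> event_times ev i" using q(4) idx_ge[OF i, of p] unfolding event_times_def by blast
    from u_event[OF i q(1) this] have "x i (t q) - z0 = u i (q - 1)" .
    moreover have "x i (t p) = x i (t q)" using state_t[OF i, of p] p q by simp
    ultimately show ?thesis using q by (intro exI[of _ "q - 1"]) auto
  qed
  then obtain \<sigma> where \<sigma>: "\<And>i p. i \<in> ?I \<Longrightarrow> B < p \<Longrightarrow>
      \<sigma> i p < p \<and> p \<le> \<sigma> i p + B \<and> x i (t p) - z0 = u i (\<sigma> i p)"
    by metis
  obtain W \<tau> where window: "\<And>a J. \<lbrakk>\<tau> \<le> a; J \<subseteq> ?I; J \<noteq> {}; J \<noteq> ?I\<rbrakk> \<Longrightarrow>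
      \<exists>p j i. a < p \<and> p \<le> a + W \<and> (j, i) \<in> parcs (ext_nbr_graph m ev t N p) \<and> j \<in> J \<and> i \<notin> J"
    by (rule repeatedly_jointly_strongly_connected_window[OF connectivity, of ?I])
      (simp add: ext_nbr_graph_def, blast)
  \<comment> \<open>\<open>B\<close> is for \<open>\<sigma>\<close>, \<open>\<tau>\<close> for the
    connectivity windows, and \<open>+ 1\<close> ensures \<open>p \<ge> 2\<close> beyond
    \<open>p0\<close>.\<close>
  define p0 where "p0 = B + \<tau> + 1"
  define s where "s i j p = (if j = i then p - 1 else \<sigma> j p)" for i j p
  have B_pos: "0 < B" using B[of 1 "Suc B"] \<open>m > 1\<close> by force
  have event_nbrs: "N i (t p) \<subseteq> ?I \<and> i \<in> N i (t p)"
    if i: "i \<in> ?I" and p: "2 \<le> p" and event: "t p \<in> event_times ev i" for i p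
    using nbrs[OF i, of "idx i p"] idx_event[OF i p event] idx_ge[OF i, of "p - 1"] by simp
  have ext: "ext_nbrs ev t N i p \<subseteq> ?I \<and> i \<in> ext_nbrs ev t N i p" if "i \<in> ?I" "2 \<le> p" for i p
    using event_nbrs[OF that] that by (simp add: ext_nbrs_def)
  interpret delayed_projected_consensus ?I S u "ext_nbrs ev t N" s B W p0
  proof
    show "finite ?I" "?I \<noteq> {}" using \<open>m > 1\<close> by auto
    show "subspace (S i)" for i by (rule subsp)
    show "u i p \<in> S i" if "i \<in> ?I" for i p unfolding u_def by (rule state_mem[OF that]) simp
    fix i p assume i: "i \<in> ?I" and "p0 < p"
    then have p: "B < p" "2 \<le> p" by (auto simp: p0_def)
    show "ext_nbrs ev t N i p \<subseteq> ?I" "i \<in> ext_nbrs ev t N i p" using ext i p by auto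
    show "s i i p = p - 1" by (simp add: s_def)
    show "s i j p < p" "p \<le> s i j p + B" if "j \<in> ext_nbrs ev t N i p" for j
      using \<sigma>[of j p] ext[OF i p(2)] that p B_pos by (auto simp: s_def)
    fix y assume y: "y \<in> S i"
    show "((1 / real (card (ext_nbrs ev t N i p))) *\<^sub>R (\<Sum>j\<in>ext_nbrs ev t N i p. u j (s i j p)) - u i p) \<bullet> y = 0"
    proof (cases "t p \<in> event_times ev i")
      \<comment> \<open>Without an event the agent averages only over itself, and
        \<open>u i p = u i (p - 1)\<close>.\<close>
      case False
      then show ?thesis using idx_no_event[OF i p(2) False] by (simp add: ext_nbrs_def s_def u_def)
    next
      case True
      let ?M = "N i (t p)"
      let ?n = "real (card ?M)"
      have M: "?M \<subseteq> ?I" "i \<in> ?M" using event_nbrs[OF i p(2) True] by auto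
      then have n: "0 < ?n" using finite_subset[OF M(1)] by (auto simp: card_gt_0_iff)
      \<comment> \<open>In these terms the update reads \<open>u i p = e - P i *v (e - a)\<close>,
        so \<open>a - u i p\<close> is minus the projection residual of \<open>e - a\<close>,
        orthogonal to \<open>S i\<close>.\<close>
      define e where "e = x i (t p) - z0"
      define a where "a = (1 / ?n) *\<^sub>R (\<Sum>j\<in>?M. x j (t p)) - z0"
      have "u j (s i j p) = x j (t p) - z0" if "j \<in> ?M" for j
        using u_event[OF i p(2) True] \<sigma>[of j p] M that p by (auto simp: s_def)
      then have mean: "(1 / ?n) *\<^sub>R (\<Sum>j\<in>?M. u j (s i j p)) = a"
        using n by (simp add: a_def sum_subtractf scaleR_diff_right sum_constant_scaleR del: sum_constant)
      have "?n *\<^sub>R x i (t p) - (\<Sum>j\<in>?M. x j (t p)) = ?n *\<^sub>R (e - a)"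
        using n by (simp add: e_def a_def scaleR_diff_right)
      moreover have "(1 / ?n) *\<^sub>R (P i *v (?n *\<^sub>R (e - a))) = P i *v (e - a)"
        using n by (simp add: matrix_vector_mult_scaleR)
      ultimately have "u i p = e - P i *v (e - a)"
        using update[OF i idx_ge[OF i, of p]] idx_event(1)[OF i p(2) True]
        by (simp add: u_def e_def)
      then have "a - u i p = - (e - a - P i *v (e - a))" by simp
      then have "(a - u i p) \<bullet> y = 0"
        using P_orth[OF i y, of "e - a"] by (simp only: inner_minus_left neg_equal_0_iff_equal)
      then show ?thesis using True mean by (simp add: ext_nbrs_def)
    qed
  next
    fix J a assume J: "J \<subseteq> ?I" "J \<noteq> {}" "J \<noteq> ?I" and "p0 \<le> a"
    then have "\<tau> \<le> a" by (simp add: p0_def)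
    from window[OF this J]
    show "\<exists>p>a. p \<le> a + W \<and> (\<exists>i\<in>?I - J. \<exists>j\<in>J. j \<in> ext_nbrs ev t N i p)"
      by (fastforce simp: ext_nbr_graph_def)
  qed
  obtain q z C where q: "0 < q" "q < 1" and z: "z \<in> K"
    and C: "\<And>i p. i \<in> ?I \<Longrightarrow> norm (u i p - z) \<le> C * q ^ p"
    by (rule exponential_consensus) blast
  have C0: "0 \<le> C" using order_trans[OF norm_ge_zero C[of 1 0]] \<open>m > 1\<close> by simp
  have "mult_rows (A i) (z0 + z) = b i" if i: "i \<in> ?I" for i
  proof -
    have "(z0 + z) - z0 \<in> kernel_rows (A i)" using z i by (auto simp: S_def)
    then show ?thesis using z0 stack_iff i unfolding diff_mem_kernel_rows_iff by simp
  qed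
  then have sol: "mult_rows (stack m A) (z0 + z) = stack m b" using stack_iff by blast
  have "converges_as_fast_as (\<lambda>p. x i (t p)) (z0 + z) q" if i: "i \<in> ?I" for i
  proof -
    define D where "D = (\<Sum>p\<le>B. norm (x i (t p) - (z0 + z)))"
    have "norm (x i (t p) - (z0 + z)) \<le> ((C + D) / q ^ B) * q ^ p" for p
    proof (cases "p \<le> B")
      case True
      have "norm (x i (t p) - (z0 + z)) \<le> D"
        unfolding D_def using True by (intro member_le_sum) auto
      also have "\<dots> \<le> (C + D) / q ^ B * q ^ B" using C0 q by simp
      also have "\<dots> \<le> (C + D) / q ^ B * q ^ p"
        using True q C0 by (intro mult_left_mono power_decreasing)
          (auto simp: D_def intro!: sum_nonneg add_nonneg_nonneg divide_nonneg_nonneg)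
      finally show ?thesis .
    next
      case False
      then have s: "p \<le> \<sigma> i p + B" "x i (t p) - z0 = u i (\<sigma> i p)" using \<sigma>[OF i, of p] by auto
      have "norm (x i (t p) - (z0 + z)) = norm (u i (\<sigma> i p) - z)" by (simp flip: s(2) add: algebra_simps)
      also have "\<dots> \<le> C * q ^ \<sigma> i p" by (rule C[OF i])
      also have "\<dots> = C / q ^ B * q ^ (\<sigma> i p + B)" using q by (simp add: power_add)
      also have "\<dots> \<le> C / q ^ B * q ^ p"
        using s(1) q C0 by (intro mult_left_mono power_decreasing) auto
      also have "\<dots> \<le> (C + D) / q ^ B * q ^ p"
        using q by (intro mult_right_mono divide_right_mono) (auto simp: D_def intro!: sum_nonneg)
      finally show ?thesis .
    qed
    then show ?thesis unfolding converges_as_fast_as_def by blast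
  qed
  then show ?thesis
    using q sol converges_as_fast_as_tendsto by blast
qed

end
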